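(* Let $N\ge 2$, let $X_1,\dots,X_N$ be nonempty sets, $X=X_1\times\cdots\times X_N$, and for each $1\le i<j\le N$ let $c_{i,j}:X_i\times X_j\to\mathbb{R}$ be a function. Define $c:X\to\mathbb{R}$ by $c(x_1,\dots,x_N)=\sum_{1\le i<j\le N}c_{i,j}(x_i,x_j)$. Let $\Gamma$ be a nonempty subset of $X$, and for $1\le i<j\le N$ let $\Gamma_{i,j}=P_{i,j}(\Gamma)$, where $P_{i,j}:X\to X_i\times X_j$, $(x_1,\dots,x_N)\mapsto(x_i,x_j)$. Suppose that for each $1\le i<j\le N$ the set $\Gamma_{i,j}$ is $c_{i,j}$-cyclically monotone. Then: (1) $\Gamma$ is $c$-cyclically monotone. (2) There exist proper functions $f_{i,j}:X_i\to\,]-\infty,+\infty]$ such that $\Gamma_{i,j}\subseteq\operatorname{gra}(\partial_{c_{i,j}}f_{i,j})$ for each $1\le i<j\le N$. In particular, given $(s_1,\dots,s_N)\in\Gamma$, one can take $f_{i,j}=R_{[c_{i,j},\Gamma_{i,j},s_i]}$. (3) Consequently, for such functions $f_{i,j}$, the functions $u_i:X_i\to\,]-\infty,+\infty]$, $1\le i\le N$, defined by $$u_i(x_i)=\sum_{i<k\le N}f_{i,k}(x_i)+\sum_{1\le k<i}f_{k,i}^{c_{k,i}}(x_i)$$ form a $c$-splitting tuple of $\Gamma$, that is, $$c(x_1,\dots,x_N)\le\sum_{i=1}^N u_i(x_i)\qquad\text{for all }(x_1,\dots,x_N)\in X,$$ and equality holds for every $(x_1,\dots,x_N)\in\Gamma$.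 (4) Furthermore, if $\Gamma_{i,j}=\operatorname{gra}(\partial_{c_{i,j}}f_{i,j})$ for each $1\le i<j\le N$ and $\Gamma=\bigcap_{1\le i<j\le N}P_{i,j}^{-1}(\Gamma_{i,j})$, then equality in the inequality of (3) holds if and only if $(x_1,\dots,x_N)\in\Gamma$.
   Context: **Cyclic monotonicity.** For sets $Y_1,\dots,Y_M$ ($M\ge2$) and a function $b:Y_1\times\cdots\times Y_M\to\mathbb{R}$, a subset $G\subseteq Y_1\times\cdots\times Y_M$ is $n$-$b$-monotone if for all $n$ points $(y_1^1,\dots,y_M^1),\dots,(y_1^n,\dots,y_M^n)$ in $G$ and all permutations $\sigma_1,\dots,\sigma_M$ of $\{1,\dots,n\}$, $$\sum_{j=1}^n b(y_1^{\sigma_1(j)},\dots,y_M^{\sigma_M(j)})\le\sum_{j=1}^n b(y_1^j,\dots,y_M^j).$$ $G$ is $b$-cyclically monotone if it is $n$-$b$-monotone for every $n\in\{2,3,\dots\}$. (For $\Gamma$ this is used with $M=N$, $b=c$; for $\Gamma_{i,j}\subseteq X_i\times X_j$ with $M=2$, $b=c_{i,j}$.) **Two-marginal notions.** Let $b:Y_1\times Y_2\to\mathbb{R}$. A function $f:Y_1\to\,]-\infty,+\infty]$ is proper if $f\not\equiv+\infty$. The $b$-conjugate of $f$ is $f^b:Y_2\to[-\infty,+\infty]$, $f^b(y_2)=\sup_{y_1\in Y_1}\big(b(y_1,y_2)-f(y_1)\big)$. For proper $f$, the $b$-subdifferential $\partial_b f:Y_1\rightrightarrows Y_2$ is the set-valued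 map $$\partial_b f(y_1)=\{y_2\in Y_2 : f(y_1)+b(y_1',y_2)\le f(y_1')+b(y_1,y_2)\ \ \forall y_1'\in Y_1\}=\{y_2\in Y_2: f(y_1)+f^b(y_2)=b(y_1,y_2)\},$$ and $\operatorname{gra}(\partial_b f)=\{(y_1,y_2)\in Y_1\times Y_2: y_2\in\partial_b f(y_1)\}$. **The function $R$.** For a nonempty $G\subseteq Y_1\times Y_2$ and a point $s$ in the projection of $G$ onto $Y_1$, the function $R_{[b,G,s]}$ on $Y_1$ is $$R_{[b,G,s]}(y)=\sup\ \sum_{j=1}^n\big(b(y_1^{j+1},y_2^j)-b(y_1^j,y_2^j)\big),$$ where the supremum is over all integers $n\ge1$ and all points $(y_1^1,y_2^1),\dots,(y_1^n,y_2^n)\in G$ with $y_1^1=s$, and where $y_1^{n+1}:=y$. **Splitting tuples.** A tuple $(u_1,\dots,u_N)$ of functions $u_i:X_i\to\,]-\infty,+\infty]$ is a $c$-splitting tuple of $\Gamma\subseteq X$ if $c(x_1,\dots,x_N)\le\sum_{i=1}^N u_i(x_i)$ for all $(x_1,\dots,x_N)\in X$, with equality for all $(x_1,\dots,x_N)\in\Gamma$. *)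

theory Defs
  imports "HOL-Library.Extended_Real" "HOL-Library.FuncSet" "HOL-Combinatorics.Permutations"
begin

section \<open>Cyclic monotonicity\<close>

text \<open>
  A point of the product of sets \<open>Y 1, ..., Y M\<close> is an element of \<open>PiE {1..M} Y\<close>.  The sets live in
  one type, which is no restriction, since any family of sets embeds in its disjoint union.
  The points of the test family are \<open>y 1, ..., y n\<close>, so \<open>y j i\<close> is the \<open>i\<close>-th coordinate of the
  \<open>j\<close>-th point.
\<close>

definition n_monotone :: "nat \<Rightarrow> ((nat \<Rightarrow> 'a) \<Rightarrow> real) \<Rightarrow> nat \<Rightarrow> (nat \<Rightarrow> 'a) set \<Rightarrow> bool" where
  "n_monotone M b n G \<longleftrightarrow>
     (\<forall>y \<sigma>. (\<forall>j\<in>{1..n}. y j \<in> G) \<longrightarrow> (\<forall>i\<in>{1..M}. \<sigma> i permutes {1..n}) \<longrightarrow>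
        (\<Sum>j=1..n. b (\<lambda>i\<in>{1..M}. y (\<sigma> i j) i)) \<le> (\<Sum>j=1..n. b (y j)))"

definition cyclically_monotone :: "nat \<Rightarrow> ((nat \<Rightarrow> 'a) \<Rightarrow> real) \<Rightarrow> (nat \<Rightarrow> 'a) set \<Rightarrow> bool" where
  "cyclically_monotone M b G \<longleftrightarrow> (\<forall>n\<ge>2. n_monotone M b n G)"

text \<open>The case \<open>M = 2\<close>, written for sets of pairs; see \<open>cyclically_monotone2_iff\<close> below.\<close>

definition n_monotone2 :: "('a \<Rightarrow> 'b \<Rightarrow> real) \<Rightarrow> nat \<Rightarrow> ('a \<times> 'b) set \<Rightarrow> bool" where
  "n_monotone2 b n G \<longleftrightarrow>
     (\<forall>y1 y2 \<sigma>1 \<sigma>2. (\<forall>j\<in>{1..n}. (y1 j, y2 j) \<in> G) \<longrightarrow>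
        \<sigma>1 permutes {1..n} \<longrightarrow> \<sigma>2 permutes {1..n} \<longrightarrow>
        (\<Sum>j=1..n. b (y1 (\<sigma>1 j)) (y2 (\<sigma>2 j))) \<le> (\<Sum>j=1..n. b (y1 j) (y2 j)))"

definition cyclically_monotone2 :: "('a \<Rightarrow> 'b \<Rightarrow> real) \<Rightarrow> ('a \<times> 'b) set \<Rightarrow> bool" where
  "cyclically_monotone2 b G \<longleftrightarrow> (\<forall>n\<ge>2. n_monotone2 b n G)"

lemma n_monotone2_iff:
  fixes b :: "'a \<Rightarrow> 'a \<Rightarrow> real"
  shows "n_monotone2 b n G \<longleftrightarrow>
    n_monotone 2 (\<lambda>y. b (y 1) (y 2)) n {y \<in> extensional {1..2}. (y 1, y 2) \<in> G}"
proof
  assume L: "n_monotone2 b n G"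
  show "n_monotone 2 (\<lambda>y. b (y 1) (y 2)) n {y \<in> extensional {1..2}. (y 1, y 2) \<in> G}"
    unfolding n_monotone_def
  proof (intro allI impI)
    fix y :: "nat \<Rightarrow> nat \<Rightarrow> 'a" and \<sigma> :: "nat \<Rightarrow> nat \<Rightarrow> nat"
    assume "\<forall>j\<in>{1..n}. y j \<in> {y \<in> extensional {1..2}. (y 1, y 2) \<in> G}"
      and "\<forall>i\<in>{1..2}. \<sigma> i permutes {1..n}"
    then show "(\<Sum>j=1..n. b ((\<lambda>i\<in>{1..2}. y (\<sigma> i j) i) 1) ((\<lambda>i\<in>{1..2}. y (\<sigma> i j) i) 2))
        \<le> (\<Sum>j=1..n. b (y j 1) (y j 2))"
      using L[unfolded n_monotone2_def, rule_format, of "\<lambda>j. y j 1" "\<lambda>j. y j 2" "\<sigma> 1" "\<sigma> 2"]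
      by simp
  qed
next
  assume R: "n_monotone 2 (\<lambda>y. b (y 1) (y 2)) n {y \<in> extensional {1..2}. (y 1, y 2) \<in> G}"
  show "n_monotone2 b n G"
    unfolding n_monotone2_def
  proof (intro allI impI)
    fix y1 y2 :: "nat \<Rightarrow> 'a" and \<sigma>1 \<sigma>2 :: "nat \<Rightarrow> nat"
    assume "\<forall>j\<in>{1..n}. (y1 j, y2 j) \<in> G" "\<sigma>1 permutes {1..n}" "\<sigma>2 permutes {1..n}"
    then show "(\<Sum>j=1..n. b (y1 (\<sigma>1 j)) (y2 (\<sigma>2 j))) \<le> (\<Sum>j=1..n. b (y1 j) (y2 j))"
      using R[unfolded n_monotone_def, rule_format,
          of "\<lambda>j. \<lambda>i\<in>{1..2}. if i = 1 then y1 j else y2 j" "\<lambda>i. if i = 1 then \<sigma>1 else \<sigma>2"]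
      by simp
  qed
qed

lemma cyclically_monotone2_iff:
  fixes b :: "'a \<Rightarrow> 'a \<Rightarrow> real"
  shows "cyclically_monotone2 b G \<longleftrightarrow>
    cyclically_monotone 2 (\<lambda>y. b (y 1) (y 2)) {y \<in> extensional {1..2}. (y 1, y 2) \<in> G}"
  unfolding cyclically_monotone2_def cyclically_monotone_def n_monotone2_iff ..

section \<open>Two-marginal notions\<close>

text \<open>
  Functions on \<open>Y1\<close> are total functions of which only the values on \<open>Y1\<close> matter.  Properness also
  records that the values on \<open>Y1\<close> lie in \<open>]-\<infinity>, +\<infinity>]\<close>.
\<close>

definition proper_on :: "'a set \<Rightarrow> ('a \<Rightarrow> ereal) \<Rightarrow> bool" where
  "proper_on Y1 f \<longleftrightarrow> (\<forall>y\<in>Y1. f y \<noteq> -\<infinity>) \<and> (\<exists>y\<in>Y1. f y \<noteq> \<infinity>)"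

definition conjugate :: "'a set \<Rightarrow> ('a \<Rightarrow> 'b \<Rightarrow> real) \<Rightarrow> ('a \<Rightarrow> ereal) \<Rightarrow> 'b \<Rightarrow> ereal" where
  "conjugate Y1 b f y2 = (SUP y1\<in>Y1. ereal (b y1 y2) - f y1)"

definition subdifferential ::
  "'a set \<Rightarrow> 'b set \<Rightarrow> ('a \<Rightarrow> 'b \<Rightarrow> real) \<Rightarrow> ('a \<Rightarrow> ereal) \<Rightarrow> 'a \<Rightarrow> 'b set" where
  "subdifferential Y1 Y2 b f y1 =
     {y2 \<in> Y2. \<forall>y1'\<in>Y1. f y1 + ereal (b y1' y2) \<le> f y1' + ereal (b y1 y2)}"

lemma mem_subdifferential_iff:
  assumes f: "proper_on Y1 f" and "y1 \<in> Y1" "y2 \<in> Y2"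
  shows "y2 \<in> subdifferential Y1 Y2 b f y1 \<longleftrightarrow> f y1 + conjugate Y1 b f y2 = ereal (b y1 y2)"
proof -
  obtain z where z: "z \<in> Y1" "f z \<noteq> \<infinity>" "f z \<noteq> -\<infinity>"
    using f by (auto simp: proper_on_def)
  have ge: "ereal (b y y2) - f y \<le> conjugate Y1 b f y2" if "y \<in> Y1" for y
    unfolding conjugate_def using that by (rule SUP_upper)
  show ?thesis
  proof (cases "f y1")
    case (real r)
    have "y2 \<in> subdifferential Y1 Y2 b f y1 \<longleftrightarrow>
        (\<forall>y\<in>Y1. ereal (b y y2) - f y \<le> ereal (b y1 y2) - f y1)"
    proof -
      have "ereal r + ereal (b y y2) \<le> f y + ereal (b y1 y2) \<longleftrightarrow>
          ereal (b y y2) - f y \<le> ereal (b y1 y2) - ereal r" if "y \<in> Y1" for y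
        using f that by (cases "f y") (auto simp: proper_on_def)
      then show ?thesis
        using assms by (auto simp: subdifferential_def real)
    qed
    also have "\<dots> \<longleftrightarrow> conjugate Y1 b f y2 \<le> ereal (b y1 y2) - f y1"
      by (simp add: conjugate_def SUP_le_iff)
    also have "\<dots> \<longleftrightarrow> conjugate Y1 b f y2 = ereal (b y1 y2) - f y1"
      using ge[OF \<open>y1 \<in> Y1\<close>] by auto
    also have "\<dots> \<longleftrightarrow> f y1 + conjugate Y1 b f y2 = ereal (b y1 y2)"
      by (cases "conjugate Y1 b f y2") (auto simp: real)
    finally show ?thesis .
  next
    case PInf
    have "y2 \<notin> subdifferential Y1 Y2 b f y1"
      using z PInf by (cases "f z") (auto simp: subdifferential_def intro!: bexI[of _ z])
    then show ?thesis
      using PInf by simp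
  next
    case MInf
    then show ?thesis
      using assms by (auto simp: proper_on_def)
  qed
qed

definition gra_subdifferential ::
  "'a set \<Rightarrow> 'b set \<Rightarrow> ('a \<Rightarrow> 'b \<Rightarrow> real) \<Rightarrow> ('a \<Rightarrow> ereal) \<Rightarrow> ('a \<times> 'b) set" where
  "gra_subdifferential Y1 Y2 b f =
     {(y1, y2) \<in> Y1 \<times> Y2. y2 \<in> subdifferential Y1 Y2 b f y1}"

definition R_fun :: "('a \<Rightarrow> 'b \<Rightarrow> real) \<Rightarrow> ('a \<times> 'b) set \<Rightarrow> 'a \<Rightarrow> 'a \<Rightarrow> ereal" where
  "R_fun b G s y =
     Sup {ereal (\<Sum>j=1..n. b (y1 (j + 1)) (y2 j) - b (y1 j) (y2 j)) | (n :: nat) y1 y2.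
            1 \<le> n \<and> (\<forall>j\<in>{1..n}. (y1 j, y2 j) \<in> G) \<and> y1 1 = s \<and> y1 (n + 1) = y}"

section \<open>Multi-marginal notions\<close>

definition index_pairs :: "nat \<Rightarrow> (nat \<times> nat) set" where
  "index_pairs N = {(i, j). 1 \<le> i \<and> i < j \<and> j \<le> N}"

definition pair_proj :: "nat \<Rightarrow> nat \<Rightarrow> (nat \<Rightarrow> 'a) \<Rightarrow> 'a \<times> 'a" where
  "pair_proj i j x = (x i, x j)"

definition total_cost :: "nat \<Rightarrow> (nat \<Rightarrow> nat \<Rightarrow> 'a \<Rightarrow> 'a \<Rightarrow> real) \<Rightarrow> (nat \<Rightarrow> 'a) \<Rightarrow> real" where
  "total_cost N c x = (\<Sum>(i, j)\<in>index_pairs N. c i j (x i) (x j))"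

definition splitting_tuple ::
  "nat \<Rightarrow> (nat \<Rightarrow> 'a set) \<Rightarrow> ((nat \<Rightarrow> 'a) \<Rightarrow> real) \<Rightarrow> (nat \<Rightarrow> 'a) set \<Rightarrow> (nat \<Rightarrow> 'a \<Rightarrow> ereal) \<Rightarrow> bool"
where
  "splitting_tuple N X b \<Gamma> u \<longleftrightarrow>
     (\<forall>i\<in>{1..N}. \<forall>t\<in>X i. u i t \<noteq> -\<infinity>) \<and>
     (\<forall>x\<in>PiE {1..N} X. ereal (b x) \<le> (\<Sum>i=1..N. u i (x i))) \<and>
     (\<forall>x\<in>\<Gamma>. ereal (b x) = (\<Sum>i=1..N. u i (x i)))"

definition split_fun ::
  "nat \<Rightarrow> (nat \<Rightarrow> 'a set) \<Rightarrow> (nat \<Rightarrow> nat \<Rightarrow> 'a \<Rightarrow> 'a \<Rightarrow> real) \<Rightarrow> (nat \<Rightarrow> nat \<Rightarrow> 'a \<Rightarrow> ereal)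
    \<Rightarrow> nat \<Rightarrow> 'a \<Rightarrow> ereal"
where
  "split_fun N X c f i t =
     (\<Sum>k\<in>{i<..N}. f i k t) + (\<Sum>k\<in>{1..<i}. conjugate (X k) (c k i) (f k i) t)"

end

theory Submission imports Defs begin

text \<open>
  By definition of the conjugate, \<open>f + f\<^sup>b\<close> dominates \<open>b\<close>, with equality exactly on the graph of the
  subdifferential of \<open>f\<close>.  Summing these two-marginal inequalities over all pairs of indices and
  collecting the terms that depend on the same coordinate gives the splitting inequality; as all
  summands are bounded below by finite values, equality in the sum forces equality for every pair.
  Potentials \<open>f\<close> come from Rockafellar's construction \<open>R\<close>: closing a chain at \<open>s\<close> turns its sum into
  the one for a cyclic permutation, so cyclic monotonicity gives \<open>R s \<le> 0\<close>, and appending a point of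
  \<open>G\<close> to a chain gives the subdifferential inequality.
\<close>

section \<open>Rockafellar's potential\<close>

text \<open>This cycle turns the successor step of a closed chain into a permutation. The last
  branch is there because \<open>permutes\<close> demands the identity outside
  \<open>{1..n}\<close>.\<close>

lemma cyclic_shift_permutes:
  assumes "1 \<le> n"
  shows "(\<lambda>j. if j = n then 1 else if j \<in> {1..<n} then j + 1 else j) permutes {1..n::nat}"
    (is "?\<sigma> permutes _")
proof (rule bij_imp_permutes)
  have "inj_on ?\<sigma> {1..n}" "?\<sigma> ` {1..n} \<subseteq> {1..n}"
    using assms by (auto simp: inj_on_def)
  then show "bij_betw ?\<sigma> {1..n} {1..n}"
    unfolding bij_betw_def by (intro conjI endo_inj_surj finite_atLeastAtMost)
qed (use assms in auto)

lemma cyclically_monotone2_closed_chain: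
  fixes n :: nat
  assumes "cyclically_monotone2 b G" and "1 \<le> n"
    and G: "\<forall>j\<in>{1..n}. (y1 j, y2 j) \<in> G" and closed: "y1 (n + 1) = y1 1"
  shows "(\<Sum>j=1..n. b (y1 (j + 1)) (y2 j) - b (y1 j) (y2 j)) \<le> 0"
\<comment> \<open>Cyclic monotonicity speaks only of \<open>n \<ge> 2\<close>; for
  \<open>n = 1\<close> the single summand vanishes by \<open>closed\<close>.\<close>
proof (cases "n = 1")
  case True
  then show ?thesis using closed by simp
next
  case False
  let ?\<sigma> = "\<lambda>j. if j = n then 1 else if j \<in> {1..<n} then j + 1 else j"
  have "n_monotone2 b n G"
    using assms False by (simp add: cyclically_monotone2_def)
  then have "(\<Sum>j=1..n. b (y1 (?\<sigma> j)) (y2 (id j))) \<le> (\<Sum>j=1..n. b (y1 j) (y2 j))"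
    using G cyclic_shift_permutes[OF \<open>1 \<le> n\<close>] permutes_id unfolding n_monotone2_def by blast
  \<comment> \<open>Only \<open>j = n\<close> needs an argument: there \<open>?\<sigma>\<close>
    returns 1, and \<open>closed\<close> identifies \<open>y1 1\<close> with
    \<open>y1 (n + 1)\<close>.\<close>
  moreover have "(\<Sum>j=1..n. b (y1 (?\<sigma> j)) (y2 (id j))) = (\<Sum>j=1..n. b (y1 (j + 1)) (y2 j))"
    using closed by (intro sum.cong) auto
  ultimately show ?thesis by (simp add: sum_subtractf)
qed

lemma R_fun_upper:
  fixes n :: nat
  assumes "1 \<le> n" "\<forall>j\<in>{1..n}. (y1 j, y2 j) \<in> G" "y1 1 = s" "y1 (n + 1) = y"
  shows "ereal (\<Sum>j=1..n. b (y1 (j + 1)) (y2 j) - b (y1 j) (y2 j)) \<le> R_fun b G s y"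
  unfolding R_fun_def using assms by (intro Sup_upper) blast

lemma R_fun_least:
  assumes "\<And>(n::nat) y1 y2. 1 \<le> n \<Longrightarrow> \<forall>j\<in>{1..n}. (y1 j, y2 j) \<in> G \<Longrightarrow> y1 1 = s \<Longrightarrow>
    y1 (n + 1) = y \<Longrightarrow> ereal (\<Sum>j=1..n. b (y1 (j + 1)) (y2 j) - b (y1 j) (y2 j)) \<le> z"
  shows "R_fun b G s y \<le> z"
  unfolding R_fun_def using assms by (intro Sup_least) blast

lemma proper_on_R_fun:
  assumes cm: "cyclically_monotone2 b G" and G: "(s, t) \<in> G" and s: "s \<in> Y1"
  shows "proper_on Y1 (R_fun b G s)"
proof -
  \<comment> \<open>The one-point chain through \<open>(s, t)\<close> ending in \<open>y\<close>
    gives a finite lower bound at every \<open>y\<close>.\<close>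
  have "ereal (b y t - b s t) \<le> R_fun b G s y" for y
    using R_fun_upper[of 1 "\<lambda>j. if j = 1 then s else y" "\<lambda>_. t" G s y b] G by simp
  then have "R_fun b G s y \<noteq> -\<infinity>" for y
    by (metis ereal_infty_less_eq(2) MInfty_neq_ereal(1))
  \<comment> \<open>Every chain from \<open>s\<close> to \<open>s\<close> is closed, so
    \<open>s\<close> itself is a point where the potential is finite.\<close>
  moreover have "R_fun b G s s \<le> ereal 0"
    by (rule R_fun_least) (simp only: ereal_less_eq cyclically_monotone2_closed_chain[OF cm])
  then have "R_fun b G s s \<noteq> \<infinity>"
    by auto
  ultimately show ?thesis
    using s by (auto simp: proper_on_def)
qed

lemma R_fun_subgradient:
  assumes G: "(y, t) \<in> G"
  shows "R_fun b G s y + ereal (b y' t) \<le> R_fun b G s y' + ereal (b y t)"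
proof -
  \<comment> \<open>With the real terms moved to the right, the supremum can be bounded chain by
    chain.\<close>
  have "R_fun b G s y \<le> R_fun b G s y' + ereal (b y t - b y' t)"
  proof (rule R_fun_least)
    fix n :: nat and y1 y2
    assume n: "1 \<le> n" "\<forall>j\<in>{1..n}. (y1 j, y2 j) \<in> G" "y1 1 = s" "y1 (n + 1) = y"
    \<comment> \<open>Position \<open>n + 1\<close> of \<open>y1\<close> already holds the old
      endpoint \<open>y\<close>; it becomes the first coordinate of the appended point
      \<open>(y, t)\<close>, and the new endpoint \<open>y'\<close> goes to
      \<open>n + 2\<close>.\<close>
    define z1 z2 where "z1 = y1(n + 2 := y')" and "z2 = y2(n + 1 := t)"
    have "ereal (\<Sum>j=1..n + 1. b (z1 (j + 1)) (z2 j) - b (z1 j) (z2 j)) \<le> R_fun b G s y'"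
      by (rule R_fun_upper) (use n G in \<open>auto simp: z1_def z2_def le_Suc_eq\<close>)
    moreover have "(\<Sum>j=1..n + 1. b (z1 (j + 1)) (z2 j) - b (z1 j) (z2 j))
        = (\<Sum>j=1..n. b (y1 (j + 1)) (y2 j) - b (y1 j) (y2 j)) + (b y' t - b y t)"
      using n by (simp add: z1_def z2_def)
    ultimately show "ereal (\<Sum>j=1..n. b (y1 (j + 1)) (y2 j) - b (y1 j) (y2 j))
        \<le> R_fun b G s y' + ereal (b y t - b y' t)"
      by (cases "R_fun b G s y'") auto
  qed
  then show ?thesis
    by (cases "R_fun b G s y"; cases "R_fun b G s y'") auto
qed

lemma subset_gra_subdifferential_R_fun:
  assumes "G \<subseteq> Y1 \<times> Y2"
  shows "G \<subseteq> gra_subdifferential Y1 Y2 b (R_fun b G s)"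
  using assms by (auto simp: gra_subdifferential_def subdifferential_def R_fun_subgradient)

section \<open>Conjugates\<close>

text \<open>A point where \<open>f\<close> is finite contributes a finite term to the
  supremum.\<close>

lemma conjugate_ne_MInfty:
  assumes "proper_on Y1 f"
  shows "conjugate Y1 b f t \<noteq> -\<infinity>"
proof -
  obtain z where z: "z \<in> Y1" "f z \<noteq> \<infinity>" "f z \<noteq> -\<infinity>"
    using assms by (auto simp: proper_on_def)
  then have "ereal (b z t) - f z \<le> conjugate Y1 b f t"
    unfolding conjugate_def by (intro SUP_upper)
  then show ?thesis
    using z by (cases "f z") auto
qed

text \<open>The Fenchel-Young inequality for \<open>b\<close>-conjugates: the term of
  \<open>y\<close> in the supremum, with \<open>f y\<close> moved across. Neither summand is
  \<open>-\<infinity>\<close>, so only finite values and \<open>\<infinity>\<close> remain to be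
  checked.\<close>

lemma young_inequality:
  assumes "proper_on Y1 f" "y \<in> Y1"
  shows "ereal (b y t) \<le> f y + conjugate Y1 b f t"
proof -
  have "ereal (b y t) - f y \<le> conjugate Y1 b f t"
    unfolding conjugate_def using assms(2) by (rule SUP_upper)
  moreover have "f y \<noteq> -\<infinity>"
    using assms by (auto simp: proper_on_def)
  ultimately show ?thesis
    using conjugate_ne_MInfty[OF assms(1), of b t]
    by (cases "f y"; cases "conjugate Y1 b f t") auto
qed

lemma mem_gra_subdifferential_iff:
  assumes "proper_on Y1 f" "y \<in> Y1" "t \<in> Y2"
  shows "(y, t) \<in> gra_subdifferential Y1 Y2 b f \<longleftrightarrow> f y + conjugate Y1 b f t = ereal (b y t)"
  using mem_subdifferential_iff[OF assms] assms by (simp add: gra_subdifferential_def)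

section \<open>Sums over pairs of indices\<close>

lemma sum_ereal_ne_MInfty:
  assumes "\<And>a. a \<in> A \<Longrightarrow> h a \<noteq> -\<infinity>"
  shows "sum h A \<noteq> (-\<infinity> :: ereal)"
  using assms by (induction A rule: infinite_finite_induct) auto

text \<open>Split off the summand \<open>a\<close>. The total is real and both pieces have real
  lower bounds, so both are finite; an excess in \<open>h a\<close> could not be compensated by the
  rest.\<close>

lemma sum_ereal_eq_imp_eq:
  fixes h :: "'b \<Rightarrow> ereal"
  assumes "finite A" and "\<And>a. a \<in> A \<Longrightarrow> ereal (g a) \<le> h a" and "ereal (sum g A) = sum h A"
    and "a \<in> A"
  shows "h a = ereal (g a)"
proof -
  have le: "ereal (sum g (A - {a})) \<le> sum h (A - {a})"
    unfolding sum_ereal[symmetric] by (rule sum_mono) (use assms in auto)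
  have "ereal (g a + sum g (A - {a})) = h a + sum h (A - {a})"
    using assms(1,3,4) by (metis sum.remove)
  then show ?thesis
    using le assms(2)[OF \<open>a \<in> A\<close>] by (cases "h a"; cases "sum h (A - {a})") auto
qed

lemma index_pairs_eq_Sigma: "index_pairs N = Sigma {1..N} (\<lambda>i. {i<..N})"
  by (auto simp: index_pairs_def)

lemma finite_index_pairs: "finite (index_pairs N)"
  by (simp add: index_pairs_eq_Sigma)

lemma sum_index_pairs_fst:
  "(\<Sum>(i, j)\<in>index_pairs N. F i j) = (\<Sum>i=1..N. \<Sum>j\<in>{i<..N}. F i j)"
  unfolding index_pairs_eq_Sigma by (rule sum.Sigma[symmetric]) auto

lemma sum_index_pairs_snd:
  "(\<Sum>(i, j)\<in>index_pairs N. F i j) = (\<Sum>j=1..N. \<Sum>i\<in>{1..<j}. F i j)"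
proof -
  \<comment> \<open>Swapping the pairs makes the larger index the outer one of a
    \<open>Sigma\<close>.\<close>
  have "(\<Sum>(i, j)\<in>index_pairs N. F i j) = (\<Sum>(j, i)\<in>Sigma {1..N} (\<lambda>j. {1..<j}). F i j)"
    by (rule sum.reindex_bij_witness[of _ prod.swap prod.swap]) (auto simp: index_pairs_def)
  also have "\<dots> = (\<Sum>j=1..N. \<Sum>i\<in>{1..<j}. F i j)"
    by (rule sum.Sigma[symmetric]) auto
  finally show ?thesis .
qed

text \<open>For a pair \<open>i < j\<close> the potential depends on \<open>x i\<close> and its
  conjugate on \<open>x j\<close>. Grouping the former by the smaller index and the latter by the
  larger one produces the two sums in \<open>split_fun\<close>.\<close>

lemma sum_split_fun:
  "(\<Sum>i=1..N. split_fun N X c f i (x i)) =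
    (\<Sum>(i, j)\<in>index_pairs N. f i j (x i) + conjugate (X i) (c i j) (f i j) (x j))"
proof -
  have "(\<Sum>(i, j)\<in>index_pairs N. f i j (x i) + conjugate (X i) (c i j) (f i j) (x j)) =
      (\<Sum>(i, j)\<in>index_pairs N. f i j (x i)) +
      (\<Sum>(i, j)\<in>index_pairs N. conjugate (X i) (c i j) (f i j) (x j))"
    by (simp add: case_prod_unfold sum.distrib)
  also have "\<dots> = (\<Sum>i=1..N. split_fun N X c f i (x i))"
    \<comment> \<open>Both grouping rules match either sum; the instances fix which one applies
      where.\<close>
    unfolding sum_index_pairs_fst[of "\<lambda>i j. f i j (x i)"]
      sum_index_pairs_snd[of "\<lambda>i j. conjugate (X i) (c i j) (f i j) (x j)"]
    by (simp add: split_fun_def sum.distrib)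
  finally show ?thesis ..
qed

section \<open>Cyclic monotonicity of the total cost\<close>

lemma cyclically_monotone_total_cost:
  assumes "\<forall>(i, j)\<in>index_pairs N. cyclically_monotone2 (c i j) (pair_proj i j ` \<Gamma>)"
  shows "cyclically_monotone N (total_cost N c) \<Gamma>"
  unfolding cyclically_monotone_def n_monotone_def
proof (intro allI impI)
  fix n :: nat and y :: "nat \<Rightarrow> nat \<Rightarrow> 'a" and \<sigma> :: "nat \<Rightarrow> nat \<Rightarrow> nat"
  assume n: "2 \<le> n" and y: "\<forall>j\<in>{1..n}. y j \<in> \<Gamma>" and \<sigma>: "\<forall>i\<in>{1..N}. \<sigma> i permutes {1..n}"
  have "(\<Sum>k=1..n. total_cost N c (\<lambda>i\<in>{1..N}. y (\<sigma> i k) i)) =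
      (\<Sum>(i, j)\<in>index_pairs N. \<Sum>k=1..n. c i j (y (\<sigma> i k) i) (y (\<sigma> j k) j))"
    unfolding total_cost_def
    by (subst sum.swap) (auto intro!: sum.cong simp: index_pairs_def)
  \<comment> \<open>After the exchange of sums each pair can be treated alone: coordinates
    \<open>i\<close> and \<open>j\<close> of the test points form a test family in the projection,
    permuted by \<open>\<sigma> i\<close> and \<open>\<sigma> j\<close>.\<close>
  also have "\<dots> \<le> (\<Sum>(i, j)\<in>index_pairs N. \<Sum>k=1..n. c i j (y k i) (y k j))"
  proof (rule sum_mono, clarify)
    fix i j assume ij: "(i, j) \<in> index_pairs N"
    then have "n_monotone2 (c i j) n (pair_proj i j ` \<Gamma>)"
      using assms n by (auto simp: cyclically_monotone2_def)
    moreover have "\<forall>k\<in>{1..n}. (y k i, y k j) \<in> pair_proj i j ` \<Gamma>"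
      using y by (auto simp: pair_proj_def)
    moreover have "\<sigma> i permutes {1..n}" "\<sigma> j permutes {1..n}"
      using ij \<sigma> by (auto simp: index_pairs_def)
    ultimately show "(\<Sum>k=1..n. c i j (y (\<sigma> i k) i) (y (\<sigma> j k) j)) \<le> (\<Sum>k=1..n. c i j (y k i) (y k j))"
      unfolding n_monotone2_def by (elim allE[of _ "\<lambda>k. y k i"] allE[of _ "\<lambda>k. y k j"]) blast
  qed
  also have "\<dots> = (\<Sum>k=1..n. total_cost N c (y k))"
    unfolding total_cost_def by (subst sum.swap) (auto intro!: sum.cong)
  finally show "(\<Sum>k=1..n. total_cost N c (\<lambda>i\<in>{1..N}. y (\<sigma> i k) i)) \<le> (\<Sum>k=1..n. total_cost N c (y k))" .
qed

section \<open>The splitting inequality and its equality case\<close>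

lemma index_pairs_mem:
  assumes "(i, j) \<in> index_pairs N" "x \<in> PiE {1..N} X"
  shows "x i \<in> X i" "x j \<in> X j"
  using assms by (auto simp: index_pairs_def)

lemma total_cost_le_sum_split_fun:
  assumes "\<forall>(i, j)\<in>index_pairs N. proper_on (X i) (f i j)" and "x \<in> PiE {1..N} X"
  shows "ereal (total_cost N c x) \<le> (\<Sum>i=1..N. split_fun N X c f i (x i))"
  unfolding sum_split_fun total_cost_def sum_ereal[symmetric]
  using assms index_pairs_mem[OF _ assms(2)]
  by (intro sum_mono) (auto intro!: young_inequality)

lemma total_cost_eq_sum_split_fun_iff:
  assumes "\<forall>(i, j)\<in>index_pairs N. proper_on (X i) (f i j)" and x: "x \<in> PiE {1..N} X"
  shows "ereal (total_cost N c x) = (\<Sum>i=1..N. split_fun N X c f i (x i)) \<longleftrightarrow>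
    (\<forall>(i, j)\<in>index_pairs N. pair_proj i j x \<in> gra_subdifferential (X i) (X j) (c i j) (f i j))"
    (is "?L = ?R")
proof -
  let ?g = "\<lambda>(i, j). c i j (x i) (x j)"
  let ?h = "\<lambda>(i, j). f i j (x i) + conjugate (X i) (c i j) (f i j) (x j)"
  have le: "ereal (?g p) \<le> ?h p" if "p \<in> index_pairs N" for p
    using that assms index_pairs_mem[OF _ x] by (auto intro!: young_inequality)
  \<comment> \<open>Equality of the sums is equality for every pair, since Young's inequality
    \<open>le\<close> bounds each summand below by a real number.\<close>
  have "?L \<longleftrightarrow> (\<forall>p\<in>index_pairs N. ?h p = ereal (?g p))"
  proof
    assume ?L
    then have "ereal (sum ?g (index_pairs N)) = sum ?h (index_pairs N)"
      by (simp only: sum_split_fun total_cost_def)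
    then show "\<forall>p\<in>index_pairs N. ?h p = ereal (?g p)"
      using sum_ereal_eq_imp_eq[of "index_pairs N" ?g ?h, OF finite_index_pairs le] by blast
  next
    assume "\<forall>p\<in>index_pairs N. ?h p = ereal (?g p)"
    then show ?L
      unfolding sum_split_fun total_cost_def sum_ereal[symmetric] by (intro sum.cong) auto
  qed
  \<comment> \<open>Equality in Young's inequality characterizes the graph of the
    subdifferential.\<close>
  also have "\<dots> \<longleftrightarrow> ?R"
    using assms(1) index_pairs_mem[OF _ x]
    by (intro ball_cong) (auto simp: pair_proj_def mem_gra_subdifferential_iff)
  finally show ?thesis .
qed

lemma split_fun_ne_MInfty:
  assumes "\<forall>(i, j)\<in>index_pairs N. proper_on (X i) (f i j)" and "i \<in> {1..N}" "t \<in> X i"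
  shows "split_fun N X c f i t \<noteq> -\<infinity>"
proof -
  have "(\<Sum>k\<in>{i<..N}. f i k t) \<noteq> -\<infinity>"
    by (rule sum_ereal_ne_MInfty) (use assms in \<open>auto simp: index_pairs_def proper_on_def\<close>)
  moreover have "(\<Sum>k\<in>{1..<i}. conjugate (X k) (c k i) (f k i) t) \<noteq> -\<infinity>"
    by (rule sum_ereal_ne_MInfty, rule conjugate_ne_MInfty)
      (use assms in \<open>auto simp: index_pairs_def\<close>)
  ultimately show ?thesis
    by (simp add: split_fun_def)
qed

section \<open>Deduction of the four claims from the facts about pairs of indices\<close>

theorem theorem2p7:
  fixes N :: nat
    and X :: "nat \<Rightarrow> 'a set"
    and c :: "nat \<Rightarrow> nat \<Rightarrow> 'a \<Rightarrow> 'a \<Rightarrow> real"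
    and \<Gamma> :: "(nat \<Rightarrow> 'a) set"
    and \<Gamma>2 :: "nat \<Rightarrow> nat \<Rightarrow> ('a \<times> 'a) set"
  assumes "N \<ge> 2"
    and "\<forall>i\<in>{1..N}. X i \<noteq> {}"
    and "\<Gamma> \<noteq> {}"
    and "\<Gamma> \<subseteq> PiE {1..N} X"
    and "\<forall>(i, j)\<in>index_pairs N. \<Gamma>2 i j = pair_proj i j ` \<Gamma>"
    and "\<forall>(i, j)\<in>index_pairs N. cyclically_monotone2 (c i j) (\<Gamma>2 i j)"
  shows
    "cyclically_monotone N (total_cost N c) \<Gamma>
     \<and>
     (\<exists>f :: nat \<Rightarrow> nat \<Rightarrow> 'a \<Rightarrow> ereal. \<forall>(i, j)\<in>index_pairs N.
        proper_on (X i) (f i j) \<and>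
        \<Gamma>2 i j \<subseteq> gra_subdifferential (X i) (X j) (c i j) (f i j))
     \<and>
     (\<forall>s\<in>\<Gamma>. \<forall>(i, j)\<in>index_pairs N.
        proper_on (X i) (R_fun (c i j) (\<Gamma>2 i j) (s i)) \<and>
        \<Gamma>2 i j \<subseteq> gra_subdifferential (X i) (X j) (c i j) (R_fun (c i j) (\<Gamma>2 i j) (s i)))
     \<and>
     (\<forall>f :: nat \<Rightarrow> nat \<Rightarrow> 'a \<Rightarrow> ereal.
        (\<forall>(i, j)\<in>index_pairs N.
           proper_on (X i) (f i j) \<and>
           \<Gamma>2 i j \<subseteq> gra_subdifferential (X i) (X j) (c i j) (f i j)) \<longrightarrow>
        splitting_tuple N X (total_cost N c) \<Gamma> (split_fun N X c f)
        \<and>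
        ((\<forall>(i, j)\<in>index_pairs N.
            \<Gamma>2 i j = gra_subdifferential (X i) (X j) (c i j) (f i j)) \<and>
         \<Gamma> = (\<Inter>(i, j)\<in>index_pairs N. {x \<in> PiE {1..N} X. pair_proj i j x \<in> \<Gamma>2 i j}) \<longrightarrow>
         (\<forall>x\<in>PiE {1..N} X.
            ereal (total_cost N c x) = (\<Sum>i=1..N. split_fun N X c f i (x i)) \<longleftrightarrow> x \<in> \<Gamma>)))"
proof -
  note \<Gamma> = \<open>\<Gamma> \<subseteq> PiE {1..N} X\<close>
  have \<Gamma>2: "\<Gamma>2 i j = pair_proj i j ` \<Gamma>" "cyclically_monotone2 (c i j) (\<Gamma>2 i j)"
    if "(i, j) \<in> index_pairs N" for i j
    using that assms(5,6) by auto
  have R: "\<forall>(i, j)\<in>index_pairs N.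
        proper_on (X i) (R_fun (c i j) (\<Gamma>2 i j) (s i)) \<and>
        \<Gamma>2 i j \<subseteq> gra_subdifferential (X i) (X j) (c i j) (R_fun (c i j) (\<Gamma>2 i j) (s i))"
    if s: "s \<in> \<Gamma>" for s
  proof clarify
    fix i j assume ij: "(i, j) \<in> index_pairs N"
    \<comment> \<open>The coordinate \<open>s j\<close> is the partner of the base point
      \<open>s i\<close> that properness of the potential requires.\<close>
    have "(s i, s j) \<in> \<Gamma>2 i j"
      using s \<Gamma>2(1)[OF ij] by (auto simp: pair_proj_def)
    moreover have "s i \<in> X i"
      using index_pairs_mem(1)[OF ij subsetD[OF \<Gamma> s]] .
    moreover have "\<Gamma>2 i j \<subseteq> X i \<times> X j"
      using index_pairs_mem[OF ij subsetD[OF \<Gamma>]] \<Gamma>2(1)[OF ij] by (auto simp: pair_proj_def)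
    ultimately show "proper_on (X i) (R_fun (c i j) (\<Gamma>2 i j) (s i)) \<and>
        \<Gamma>2 i j \<subseteq> gra_subdifferential (X i) (X j) (c i j) (R_fun (c i j) (\<Gamma>2 i j) (s i))"
      by (intro conjI proper_on_R_fun[OF \<Gamma>2(2)[OF ij]] subset_gra_subdifferential_R_fun)
  qed
  obtain s where "s \<in> \<Gamma>"
    using \<open>\<Gamma> \<noteq> {}\<close> by blast
  have ex: "\<exists>f :: nat \<Rightarrow> nat \<Rightarrow> 'a \<Rightarrow> ereal. \<forall>(i, j)\<in>index_pairs N.
        proper_on (X i) (f i j) \<and>
        \<Gamma>2 i j \<subseteq> gra_subdifferential (X i) (X j) (c i j) (f i j)"
    by (rule exI[of _ "\<lambda>i j. R_fun (c i j) (\<Gamma>2 i j) (s i)"]) (rule R[OF \<open>s \<in> \<Gamma>\<close>])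
  have cm: "cyclically_monotone N (total_cost N c) \<Gamma>"
    by (rule cyclically_monotone_total_cost) (use \<Gamma>2 in auto)
  have split: "splitting_tuple N X (total_cost N c) \<Gamma> (split_fun N X c f)"
    if f: "\<forall>(i, j)\<in>index_pairs N. proper_on (X i) (f i j) \<and>
      \<Gamma>2 i j \<subseteq> gra_subdifferential (X i) (X j) (c i j) (f i j)" for f
  proof -
    have proper: "\<forall>(i, j)\<in>index_pairs N. proper_on (X i) (f i j)"
      using f by auto
    \<comment> \<open>Points of \<open>\<Gamma>\<close> project into every graph, which is the
      equality case of the splitting inequality.\<close>
    have "pair_proj i j x \<in> gra_subdifferential (X i) (X j) (c i j) (f i j)"
      if "x \<in> \<Gamma>" "(i, j) \<in> index_pairs N" for x i j
      using bspec[OF f that(2)] \<Gamma>2(1)[OF that(2)] that(1) by auto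
    then show ?thesis
      using \<Gamma> total_cost_le_sum_split_fun[OF proper] split_fun_ne_MInfty[OF proper]
        total_cost_eq_sum_split_fun_iff[OF proper]
      by (auto simp: splitting_tuple_def subset_iff)
  qed
  have eq: "ereal (total_cost N c x) = (\<Sum>i=1..N. split_fun N X c f i (x i)) \<longleftrightarrow> x \<in> \<Gamma>"
    if f: "\<forall>(i, j)\<in>index_pairs N. proper_on (X i) (f i j) \<and>
        \<Gamma>2 i j \<subseteq> gra_subdifferential (X i) (X j) (c i j) (f i j)"
      and gra: "\<forall>(i, j)\<in>index_pairs N. \<Gamma>2 i j = gra_subdifferential (X i) (X j) (c i j) (f i j)"
      and Int: "\<Gamma> = (\<Inter>(i, j)\<in>index_pairs N. {x \<in> PiE {1..N} X. pair_proj i j x \<in> \<Gamma>2 i j})"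
      and x: "x \<in> PiE {1..N} X" for f x
  proof -
    have "\<forall>(i, j)\<in>index_pairs N. proper_on (X i) (f i j)"
      using f by auto
    then have "ereal (total_cost N c x) = (\<Sum>i=1..N. split_fun N X c f i (x i)) \<longleftrightarrow>
        (\<forall>(i, j)\<in>index_pairs N. pair_proj i j x \<in> gra_subdifferential (X i) (X j) (c i j) (f i j))"
      by (rule total_cost_eq_sum_split_fun_iff[OF _ x])
    \<comment> \<open>By \<open>gra\<close> the equality case is membership of all projections in
      \<open>\<Gamma>2\<close>, which \<open>Int\<close> turns into membership in
      \<open>\<Gamma>\<close>.\<close>
    also have "\<dots> \<longleftrightarrow> (\<forall>(i, j)\<in>index_pairs N. pair_proj i j x \<in> \<Gamma>2 i j)"
      using gra by (intro ball_cong) auto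
    also have "\<dots> \<longleftrightarrow> x \<in> \<Gamma>"
      using x by (subst Int) auto
    finally show ?thesis .
  qed
  show ?thesis
    by (intro conjI cm ex, rule ballI, erule R, intro allI impI conjI, erule split,
        elim conjE, rule ballI, rule eq)
qed

end
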